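(* Let $(\Omega,\Sigma,\mu)$ be a measure space with $\mu$ a countably additive positive measure with values in $\mathbb{R}\cup\{\infty\}$, let $\rho:\Omega\to[0,\infty)$ be measurable, let $\mathbb{K}\in\{\mathbb{R},\mathbb{C}\}$, let $A,a\in\mathbb{K}$ and $f,g\in L^2_\rho(\Omega,\mathbb{K})$. The conditions $$\int_\Omega \operatorname{Re}\left[(Ag(s)-f(s))\left(\overline{f(s)}-\overline{a}\,\overline{g(s)}\right)\right]\rho(s)\,d\mu(s)\ge 0$$ and $$\int_\Omega \rho(s)\left|f(s)-\frac{a+A}{2}g(s)\right|^2 d\mu(s)\le \frac14|A-a|^2\int_\Omega\rho(s)|g(s)|^2\,d\mu(s)$$ are equivalent, and if either of them holds, then $$0\le \int_\Omega\rho(s)|f(s)|^2d\mu(s)\int_\Omega\rho(s)|g(s)|^2d\mu(s)-\left|\int_\Omega\rho(s)f(s)\overline{g(s)}\,d\mu(s)\right|^2\le \frac14|A-a|^2\left(\int_\Omega\rho(s)|g(s)|^2d\mu(s)\right)^2 .$$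
   Context: $L^2_\rho(\Omega,\mathbb{K})$ denotes the space of all measurable $\mathbb{K}$-valued functions $f$ on $\Omega$ with $\int_\Omega\rho(s)|f(s)|^2\,d\mu(s)<\infty$. *)

theory Defs
  imports "HOL-Analysis.Analysis"
begin

text \<open>The scalar field is a subset \<open>K\<close> of the complex numbers, so that \<open>K = \<real>\<close> and
  \<open>K = UNIV\<close> are treated uniformly; real-valued functions are complex-valued functions
  with values in \<open>\<real>\<close>. The elements are functions, not classes modulo equality almost
  everywhere, and they are unconstrained outside \<open>space M\<close>.\<close>

definition weighted_L2 :: "'a measure \<Rightarrow> ('a \<Rightarrow> real) \<Rightarrow> complex set \<Rightarrow> ('a \<Rightarrow> complex) set"
  where "weighted_L2 M \<rho> K =
    {f \<in> borel_measurable M. (\<forall>s\<in>space M. f s \<in> K) \<and>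
       (\<integral>\<^sup>+ s. ennreal (\<rho> s * (cmod (f s))\<^sup>2) \<partial>M) < \<infinity>}"

end

theory Submission imports Defs begin

text \<open>Condition 1 is condition 2 in disguise because pointwise
  \<open>Re ((A g - f) * cnj (f - a g)) = \<bar>A - a\<bar>\<^sup>2 \<bar>g\<bar>\<^sup>2 / 4 - \<bar>f - c g\<bar>\<^sup>2\<close> with \<open>c = (a + A) / 2\<close>.
  Writing \<open>F\<close>, \<open>G\<close>, \<open>H\<close> for the inner products \<open>\<langle>f,f\<rangle>\<close>, \<open>\<langle>g,g\<rangle>\<close>, \<open>\<langle>f,g\<rangle>\<close>, the upper bound on the
  Gram determinant follows from \<open>F G - \<bar>H\<bar>\<^sup>2 = G \<parallel>f - c g\<parallel>\<^sup>2 - \<bar>H - c G\<bar>\<^sup>2\<close>, valid for every \<open>c\<close>.\<close>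

lemma weighted_L2_integrable_square:
  assumes "\<rho> \<in> borel_measurable M"
    and "\<And>s. s \<in> space M \<Longrightarrow> 0 \<le> \<rho> s"
    and "f \<in> weighted_L2 M \<rho> K"
  shows "integrable M (\<lambda>s. \<rho> s * (cmod (f s))\<^sup>2)"
proof (rule integrableI_nonneg)
  have [measurable]: "f \<in> borel_measurable M" "\<rho> \<in> borel_measurable M"
    using assms by (auto simp: weighted_L2_def)
  show "(\<lambda>s. \<rho> s * (cmod (f s))\<^sup>2) \<in> borel_measurable M"
    by measurable
  show "AE s in M. 0 \<le> \<rho> s * (cmod (f s))\<^sup>2"
    using assms(2) by (intro AE_I2) simp
  show "(\<integral>\<^sup>+ s. ennreal (\<rho> s * (cmod (f s))\<^sup>2) \<partial>M) < \<infinity>"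
    using assms(3) by (simp add: weighted_L2_def)
qed

text \<open>Domination: \<open>2 * cmod (f s) * cmod (g s)\<close> is at most the sum of the two
  squares, so the weighted squares bound the product. Hence the inner product is a genuine integral
  and not the default value 0.\<close>

lemma weighted_L2_integrable_product:
  assumes "\<rho> \<in> borel_measurable M"
    and "\<And>s. s \<in> space M \<Longrightarrow> 0 \<le> \<rho> s"
    and "f \<in> weighted_L2 M \<rho> K" and "g \<in> weighted_L2 M \<rho> L"
  shows "integrable M (\<lambda>s. complex_of_real (\<rho> s) * f s * cnj (g s))"
proof (rule Bochner_Integration.integrable_bound)
  have [measurable]: "f \<in> borel_measurable M" "g \<in> borel_measurable M" "\<rho> \<in> borel_measurable M"
    using assms by (auto simp: weighted_L2_def)
  have [measurable]: "(\<lambda>s. cnj (g s)) \<in> borel_measurable M"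
    by (rule borel_measurable_continuous_on[of cnj]) (auto intro: continuous_intros)
  show "(\<lambda>s. complex_of_real (\<rho> s) * f s * cnj (g s)) \<in> borel_measurable M"
    by measurable
  show "integrable M (\<lambda>s. \<rho> s * (cmod (f s))\<^sup>2 + \<rho> s * (cmod (g s))\<^sup>2)"
    using assms by (intro Bochner_Integration.integrable_add weighted_L2_integrable_square)
  show "AE s in M. norm (complex_of_real (\<rho> s) * f s * cnj (g s))
      \<le> norm (\<rho> s * (cmod (f s))\<^sup>2 + \<rho> s * (cmod (g s))\<^sup>2)"
  proof (rule AE_I2)
    fix s assume "s \<in> space M"
    then have \<rho>: "0 \<le> \<rho> s" by (rule assms(2))
    have "0 \<le> (cmod (f s) - cmod (g s))\<^sup>2" "0 \<le> (cmod (f s))\<^sup>2" "0 \<le> (cmod (g s))\<^sup>2"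
      by simp_all
    then have "cmod (f s) * cmod (g s) \<le> (cmod (f s))\<^sup>2 + (cmod (g s))\<^sup>2"
      unfolding power2_diff by linarith
    from mult_left_mono[OF this \<rho>]
    show "norm (complex_of_real (\<rho> s) * f s * cnj (g s))
        \<le> norm (\<rho> s * (cmod (f s))\<^sup>2 + \<rho> s * (cmod (g s))\<^sup>2)"
      using \<rho> by (simp add: norm_mult distrib_left mult.assoc)
  qed
qed

text \<open>Expanding the square under the integral gives three integrable terms. The scalar
  \<open>c\<close> is an arbitrary complex number, even when \<open>f\<close> and \<open>g\<close>
  are real-valued.\<close>

lemma integral_weighted_square_diff:
  fixes c :: complex
  assumes "\<rho> \<in> borel_measurable M"
    and "\<And>s. s \<in> space M \<Longrightarrow> 0 \<le> \<rho> s"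
    and "f \<in> weighted_L2 M \<rho> K" and "g \<in> weighted_L2 M \<rho> L"
  shows "integrable M (\<lambda>s. \<rho> s * (cmod (f s - c * g s))\<^sup>2)" (is ?int)
    and "(\<integral>s. \<rho> s * (cmod (f s - c * g s))\<^sup>2 \<partial>M)
      = (\<integral>s. \<rho> s * (cmod (f s))\<^sup>2 \<partial>M)
        - 2 * Re (cnj c * (\<integral>s. complex_of_real (\<rho> s) * f s * cnj (g s) \<partial>M))
        + (cmod c)\<^sup>2 * (\<integral>s. \<rho> s * (cmod (g s))\<^sup>2 \<partial>M)" (is ?eq)
proof -
  let ?h = "\<lambda>s. complex_of_real (\<rho> s) * f s * cnj (g s)"
  have expand: "\<rho> s * (cmod (f s - c * g s))\<^sup>2
      = \<rho> s * (cmod (f s))\<^sup>2 - 2 * Re (cnj c * ?h s) + (cmod c)\<^sup>2 * (\<rho> s * (cmod (g s))\<^sup>2)" for s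
    unfolding cmod_power2 by (simp add: algebra_simps power2_eq_square)
  have f: "integrable M (\<lambda>s. \<rho> s * (cmod (f s))\<^sup>2)"
    and g: "integrable M (\<lambda>s. \<rho> s * (cmod (g s))\<^sup>2)"
    and h: "integrable M (\<lambda>s. cnj c * ?h s)"
    using weighted_L2_integrable_square[OF assms(1,2,3)]
      weighted_L2_integrable_square[OF assms(1,2,4)]
      weighted_L2_integrable_product[OF assms] by (auto intro: integrable_mult_right)
  have Re_h: "integrable M (\<lambda>s. 2 * Re (cnj c * ?h s))"
    by (rule integrable_mult_right[OF integrable_Re[OF h]])
  have cg: "integrable M (\<lambda>s. (cmod c)\<^sup>2 * (\<rho> s * (cmod (g s))\<^sup>2))"
    by (rule integrable_mult_right[OF g])
  show ?int
    unfolding expand by (intro Bochner_Integration.integrable_add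
        Bochner_Integration.integrable_diff f Re_h cg)
  have "(\<integral>s. Re (cnj c * ?h s) \<partial>M) = Re (\<integral>s. cnj c * ?h s \<partial>M)"
    by (rule integral_Re[OF h])
  also have "\<dots> = Re (cnj c * (\<integral>s. ?h s \<partial>M))"
    by (simp only: integral_mult_right_zero)
  finally have Re_eq: "(\<integral>s. Re (cnj c * ?h s) \<partial>M) = Re (cnj c * (\<integral>s. ?h s \<partial>M))" .
  show ?eq
    unfolding expand
    by (simp only: Bochner_Integration.integral_add[OF Bochner_Integration.integrable_diff[OF f Re_h] cg]
        Bochner_Integration.integral_diff[OF f Re_h] Re_eq integral_mult_right_zero)
qed

text \<open>Cauchy-Schwarz in abstract form: the quadratic stands for the squared norm of
  \<open>f - c g\<close>, and it is tested at a suitable \<open>c\<close>.\<close>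

lemma square_norm_le_of_nonneg_quadratic:
  fixes H :: complex
  assumes "\<And>c. 0 \<le> F - 2 * Re (cnj c * H) + (cmod c)\<^sup>2 * G" and "0 \<le> G"
  shows "(cmod H)\<^sup>2 \<le> F * G"
proof (cases "G = 0")
  case True
  have "H = 0"
  proof (rule ccontr)
    assume "H \<noteq> 0"
    \<comment> \<open>For \<open>G = 0\<close> the quadratic is affine in \<open>c\<close>. This
      \<open>t\<close> makes its value at \<open>t H\<close> equal to
      \<open>F - (F + 1) = -1\<close>.\<close>
    define t where "t = (F + 1) / (2 * (cmod H)\<^sup>2)"
    have "Re (cnj (of_real t * H) * H) = t * (cmod H)\<^sup>2"
      unfolding cmod_power2 by (simp add: power2_eq_square algebra_simps)
    then have "0 \<le> F - 2 * (t * (cmod H)\<^sup>2)"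
      using assms(1)[of "of_real t * H"] True by simp
    moreover have "2 * (t * (cmod H)\<^sup>2) = F + 1"
      using \<open>H \<noteq> 0\<close> by (simp add: t_def)
    ultimately show False by simp
  qed
  with True show ?thesis by simp
next
  case False
  \<comment> \<open>For \<open>G > 0\<close> the minimizer is the projection coefficient
    \<open>H / G\<close>, where the quadratic equals
    \<open>F - (cmod H)\<^sup>2 / G\<close>.\<close>
  have "Re (cnj (H / of_real G) * H) = (cmod H)\<^sup>2 / G"
    unfolding cmod_power2 by (simp add: power2_eq_square add_divide_distrib)
  moreover have "(cmod (H / of_real G))\<^sup>2 * G = (cmod H)\<^sup>2 / G"
    using False by (simp add: norm_divide power_divide power2_eq_square)
  ultimately have "(cmod H)\<^sup>2 / G \<le> F"
    using assms(1)[of "H / of_real G"] by linarith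
  then show ?thesis
    using False assms(2) by (simp add: divide_le_eq)
qed

text \<open>Polarization: \<open>Re (u * cnj v)\<close> is the squared modulus of
  \<open>(u + v) / 2\<close> minus that of \<open>(u - v) / 2\<close>. With
  \<open>u = A * y - x\<close> and \<open>v = x - a * y\<close>, the sum \<open>u + v\<close> is
  \<open>(A - a) * y\<close> and half the difference is \<open>(a + A) / 2 * y - x\<close>.\<close>

lemma Re_mult_cnj_midpoint:
  fixes A a x y :: complex
  shows "Re ((A * y - x) * (cnj x - cnj a * cnj y))
    = 1 / 4 * (cmod (A - a))\<^sup>2 * (cmod y)\<^sup>2 - (cmod (x - (a + A) / 2 * y))\<^sup>2"
  unfolding cmod_power2
  by (simp add: power2_eq_square field_simps)

text \<open>Expanding the last square produces the same terms in \<open>c\<close> as the product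
  with \<open>G\<close>; they cancel and leave the terms free of \<open>c\<close>.\<close>

lemma gram_identity:
  fixes H c :: complex and F G :: real
  shows "F * G - (cmod H)\<^sup>2
    = (F - 2 * Re (cnj c * H) + (cmod c)\<^sup>2 * G) * G - (cmod (H - c * of_real G))\<^sup>2"
  unfolding cmod_power2 by (simp add: power2_eq_square algebra_simps)

theorem proposition2:
  fixes M :: "'a measure" and \<rho> :: "'a \<Rightarrow> real" and K :: "complex set"
    and A a :: complex and f g :: "'a \<Rightarrow> complex"
  assumes "\<rho> \<in> borel_measurable M"
    and "\<And>s. s \<in> space M \<Longrightarrow> 0 \<le> \<rho> s"
    and "K \<in> {\<real>, UNIV}"
    and "A \<in> K" and "a \<in> K"
    and "f \<in> weighted_L2 M \<rho> K" and "g \<in> weighted_L2 M \<rho> K"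
  defines "cond1 \<equiv>
      (\<integral>s. Re ((A * g s - f s) * (cnj (f s) - cnj a * cnj (g s))) * \<rho> s \<partial>M) \<ge> 0"
    and "cond2 \<equiv>
      (\<integral>s. \<rho> s * (cmod (f s - (a + A) / 2 * g s))\<^sup>2 \<partial>M)
        \<le> 1 / 4 * (cmod (A - a))\<^sup>2 * (\<integral>s. \<rho> s * (cmod (g s))\<^sup>2 \<partial>M)"
    and "gram \<equiv>
      (\<integral>s. \<rho> s * (cmod (f s))\<^sup>2 \<partial>M) * (\<integral>s. \<rho> s * (cmod (g s))\<^sup>2 \<partial>M)
        - (cmod (\<integral>s. complex_of_real (\<rho> s) * f s * cnj (g s) \<partial>M))\<^sup>2"
  shows "(cond1 \<longleftrightarrow> cond2) \<and>
    (cond1 \<or> cond2 \<longrightarrow>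
      0 \<le> gram \<and>
      gram \<le> 1 / 4 * (cmod (A - a))\<^sup>2 * (\<integral>s. \<rho> s * (cmod (g s))\<^sup>2 \<partial>M)\<^sup>2)"
proof -
  define c where "c = (a + A) / 2"
  define F G H where "F = (\<integral>s. \<rho> s * (cmod (f s))\<^sup>2 \<partial>M)"
    and "G = (\<integral>s. \<rho> s * (cmod (g s))\<^sup>2 \<partial>M)"
    and "H = (\<integral>s. complex_of_real (\<rho> s) * f s * cnj (g s) \<partial>M)"
  let ?D = "\<lambda>c. \<integral>s. \<rho> s * (cmod (f s - c * g s))\<^sup>2 \<partial>M"
  have gram: "gram = F * G - (cmod H)\<^sup>2"
    by (simp add: gram_def F_def G_def H_def)
  \<comment> \<open>Here \<open>c\<close> is generalized and shadows the midpoint: the lower bound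
    needs all complex \<open>c\<close>, the upper bound only the midpoint.\<close>
  have D: "?D c = F - 2 * Re (cnj c * H) + (cmod c)\<^sup>2 * G" for c
    unfolding F_def G_def H_def
    by (rule integral_weighted_square_diff(2)[OF assms(1,2,6,7)])
  have D_nonneg: "0 \<le> ?D c" for c
    using assms(2) by (intro Bochner_Integration.integral_nonneg) simp
  have G_nonneg: "0 \<le> G"
    unfolding G_def using assms(2) by (intro Bochner_Integration.integral_nonneg) simp
  have "(\<integral>s. Re ((A * g s - f s) * (cnj (f s) - cnj a * cnj (g s))) * \<rho> s \<partial>M)
      = (\<integral>s. 1 / 4 * (cmod (A - a))\<^sup>2 * (\<rho> s * (cmod (g s))\<^sup>2)
          - \<rho> s * (cmod (f s - c * g s))\<^sup>2 \<partial>M)"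
    unfolding Re_mult_cnj_midpoint c_def by (simp only: algebra_simps)
  also have "\<dots> = 1 / 4 * (cmod (A - a))\<^sup>2 * G - ?D c"
    unfolding G_def
    by (simp only: Bochner_Integration.integral_diff[OF
          integrable_mult_right[OF weighted_L2_integrable_square[OF assms(1,2,7)]]
          integral_weighted_square_diff(1)[OF assms(1,2,6,7)]] integral_mult_right_zero)
  finally have equiv: "cond1 \<longleftrightarrow> cond2"
    unfolding cond1_def cond2_def G_def c_def by linarith
  have "(cmod H)\<^sup>2 \<le> F * G"
    using D_nonneg G_nonneg unfolding D by (rule square_norm_le_of_nonneg_quadratic)
  then have lower: "0 \<le> gram"
    by (simp add: gram)
  have upper: "gram \<le> 1 / 4 * (cmod (A - a))\<^sup>2 * G\<^sup>2" if cond2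
  proof -
    \<comment> \<open>At the midpoint \<open>c\<close>, dropping the subtracted square leaves
      \<open>?D c * G\<close>, and \<open>cond2\<close> bounds exactly \<open>?D c\<close>.\<close>
    have "gram = ?D c * G - (cmod (H - c * of_real G))\<^sup>2"
      unfolding gram D by (rule gram_identity)
    also have "\<dots> \<le> ?D c * G"
      by simp
    also have "\<dots> \<le> (1 / 4 * (cmod (A - a))\<^sup>2 * G) * G"
      using that unfolding cond2_def c_def G_def[symmetric]
      by (rule mult_right_mono[OF _ G_nonneg])
    finally show ?thesis
      by (simp add: power2_eq_square mult.assoc)
  qed
  show ?thesis
    using equiv lower upper unfolding G_def by blast
qed

end
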